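(* Let $\Delta$ be a finite or (countably) infinite set of algebraically independent variables over a field $K$. Then: (1) $K(\Delta)$ is Galois over $K$; (2) $K(\Delta)$ is strong Galois over $K$.
   Context: Let $L/K$ be an extension of fields (not necessarily algebraic). Galois: $L$ is Galois over $K$ if $K=\{x\in L:\sigma(x)=x\text{ for all }\sigma\in Gal(L/K)\}$, where $Gal(L/K)$ is the group of all automorphisms of $L$ fixing $K$ pointwise. Nice bases: a nice basis $(S,A)$ of $L$ over $K$ consists of a transcendence basis $S$ of $L$ over $K$ and a linear (vector space) basis $A$ of $L$ over $K(S)$, so that $L=K(S)[A]$ is algebraic over $K(S)$. A nice basis $(S,A)$ is a linearly disjoint basis of $L$ over $K$ if the fields $K(S)$ and $K(A)$ are linearly disjoint over $K$. $\Sigma[L/K]_{ld}$ denotes the set of linearly disjoint bases of $L$ over $K$. Strong Galois: $L$ is strong Galois over $K$ if $\Sigma[L/K]_{ld}$ is nonempty and $L$ is an algebraic Galois extension of $K(S)$ for every $(S,A)\in\Sigma[L/K]_{ld}$.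
   Formalization: Part (1) excludes the case where K is finite and Δ has exactly one element: there Gal(K(x)/K) = PGL_2(K) is finite, so its fixed field is larger than K and K(x) is not Galois over K; part (2) is proved without exclusion. *)

theory Defs
  imports "HOL-Algebra.Algebra" "HOL-Library.Countable_Set"
begin

text \<open>Throughout, the extension field \<open>L\<close> is the ambient ring \<open>R\<close>, the base field is a subfield
  \<open>K\<close> of \<open>R\<close>, and \<open>K(H)\<close> is \<^const>\<open>generate_field\<close> applied to \<open>K \<union> H\<close>.\<close>

context ring
begin

definition adjoin :: "'a set \<Rightarrow> 'a set \<Rightarrow> 'a set" where
  "adjoin K H = generate_field R (K \<union> H)"

text \<open>Automorphisms are HOL functions, whose values outside \<open>carrier R\<close> are irrelevant.\<close>

definition Gal :: "'a set \<Rightarrow> ('a \<Rightarrow> 'a) set" where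
  "Gal K = {\<sigma> \<in> ring_iso R R. \<forall>x\<in>K. \<sigma> x = x}"

definition galois :: "'a set \<Rightarrow> bool" where
  "galois K \<longleftrightarrow> K = {x \<in> carrier R. \<forall>\<sigma>\<in>Gal K. \<sigma> x = x}"

text \<open>Indexed polynomials whose indeterminates are themselves ring elements are evaluated by
  substituting for each indeterminate the element that names it. (The library's
  \<open>indexed_eval\<close> is a different operation.)\<close>

definition self_eval :: "('a multiset \<Rightarrow> 'a) \<Rightarrow> 'a" where
  "self_eval P =
     (\<Oplus>m\<in>{m. P m \<noteq> \<zero>}. P m \<otimes> (\<Otimes>x\<in>set_mset m. x [^] count m x))"

definition algebraically_independent :: "'a set \<Rightarrow> 'a set \<Rightarrow> bool" where
  "algebraically_independent K S \<longleftrightarrow> S \<subseteq> carrier R \<and>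
     (\<forall>P \<in> indexed_pset S K. self_eval P = \<zero> \<longrightarrow> P = indexed_const \<zero>)"

definition algebraic_extension :: "'a set \<Rightarrow> bool" where
  "algebraic_extension K \<longleftrightarrow> (\<forall>x\<in>carrier R. (algebraic over K) x)"

definition transcendence_basis :: "'a set \<Rightarrow> 'a set \<Rightarrow> bool" where
  "transcendence_basis K S \<longleftrightarrow>
     algebraically_independent K S \<and> algebraic_extension (adjoin K S)"

text \<open>\<^const>\<open>independent\<close> and \<^const>\<open>Span\<close> concern finite lists, so a possibly infinite basis is
  described through the lists over it.\<close>

definition linear_basis :: "'a set \<Rightarrow> 'a set \<Rightarrow> bool" where
  "linear_basis F A \<longleftrightarrow> A \<subseteq> carrier R \<and>
     (\<forall>us. distinct us \<and> set us \<subseteq> A \<longrightarrow> independent F us) \<and>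
     (\<forall>x\<in>carrier R. \<exists>us. set us \<subseteq> A \<and> x \<in> Span F us)"

definition nice_basis :: "'a set \<Rightarrow> 'a set \<Rightarrow> 'a set \<Rightarrow> bool" where
  "nice_basis K S A \<longleftrightarrow> transcendence_basis K S \<and> linear_basis (adjoin K S) A"

definition linearly_disjoint :: "'a set \<Rightarrow> 'a set \<Rightarrow> 'a set \<Rightarrow> bool" where
  "linearly_disjoint K E F \<longleftrightarrow>
     (\<forall>us. set us \<subseteq> E \<and> independent K us \<longrightarrow> independent F us)"

definition linearly_disjoint_bases :: "'a set \<Rightarrow> ('a set \<times> 'a set) set" where
  "linearly_disjoint_bases K =
     {(S, A). nice_basis K S A \<and> linearly_disjoint K (adjoin K S) (adjoin K A)}"

definition strong_galois :: "'a set \<Rightarrow> bool" where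
  "strong_galois K \<longleftrightarrow> linearly_disjoint_bases K \<noteq> {} \<and>
     (\<forall>(S, A) \<in> linearly_disjoint_bases K.
        algebraic_extension (adjoin K S) \<and> galois (adjoin K S))"

end

end

theory Submission
  imports Defs
begin

text \<open>Write \<open>F\<^sub>d\<close> for the field \<open>K(\<Delta> - {d})\<close>. For every \<open>d \<in> \<Delta>\<close> the field \<open>L\<close> is \<open>F\<^sub>d(d)\<close> with
  \<open>d\<close> transcendental over \<open>F\<^sub>d\<close>, so most of the argument takes place in a simple transcendental
  extension \<open>F(t)\<close>. It rests on one observation, \<open>adjoin_transcendental_Int\<close>: if \<open>t\<close> is
  transcendental even over a larger field \<open>E \<supseteq> F\<close>, then \<open>E \<inter> F(t) = F\<close>. Indeed, if
  \<open>x = f(t) / g(t)\<close> lies in \<open>E\<close>, then the polynomial \<open>f - x g\<close> over \<open>E\<close> vanishes at \<open>t\<close>, hence is zero,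
  and comparing any nonzero coefficient of \<open>g\<close> with that of \<open>f\<close> shows \<open>x \<in> F\<close>.
  Three choices of \<open>E\<close> are used.

  \<^item> \<open>E = F\<^sub>d\<close>: removing the variables that occur in \<open>x\<close> one at a time, an element that lies in
    every \<open>F\<^sub>d\<close> lies in \<open>K\<close> (\<open>adjoin_omit_Int\<close>). So it suffices to work over each \<open>F\<^sub>d\<close> separately.

  \<^item> \<open>E\<close> the field of elements algebraic over \<open>F\<close>: then \<open>F\<close> is algebraically closed in \<open>F(t)\<close>
    (\<open>algebraic_in_adjoin_transcendental\<close>), and so \<open>K\<close> is algebraically closed in \<open>L\<close>.

  \<^item> \<open>E\<close> the fixed field of \<open>Gal F\<close>, where \<open>F\<close> is infinite: for each \<open>c \<in> F\<close> there is an automorphism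
    of \<open>F(t)\<close> over \<open>F\<close> with \<open>t \<mapsto> t + c\<close>, so a polynomial over \<open>E\<close> vanishing at \<open>t\<close> has the infinitely many
    roots \<open>t + c\<close> and is zero. Hence \<open>t\<close> is transcendental over \<open>E\<close>, \<open>E = F\<close>, and \<open>F(t)\<close> is Galois over \<open>F\<close>
    (\<open>galois_adjoin_transcendental\<close>).

  For the first claim, \<open>F\<^sub>d\<close> is infinite if \<open>K\<close> is, and also if \<open>\<Delta>\<close> has a variable other than \<open>d\<close>. An
  element fixed by \<open>Gal K\<close> is fixed by the smaller group \<open>Gal F\<^sub>d\<close>, so it lies in \<open>F\<^sub>d\<close> for each \<open>d\<close>,
  and therefore in \<open>K\<close>.

  For the second claim, the pair \<open>(\<Delta>, {1})\<close> is a linearly disjoint basis. Let \<open>(S, A)\<close> be any such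
  basis and \<open>a \<in> A\<close>. Then \<open>a\<close> is algebraic over \<open>K(S)\<close>, and linear disjointness of \<open>K(S)\<close> from
  \<open>K(A)\<close> makes \<open>a\<close> algebraic over \<open>K\<close> (\<open>linearly_disjoint_algebraic\<close>), so \<open>a \<in> K\<close> as \<open>K\<close> is
  algebraically closed in \<open>L\<close>. Thus \<open>A \<subseteq> K\<close> spans only \<open>K(S)\<close>, so \<open>L = K(S)\<close>, and \<open>L\<close> is trivially
  algebraic and Galois over itself.\<close>

context field
begin

section \<open>Polynomial relations of one element\<close>

text \<open>Elements of \<^term>\<open>carrier (F[X])\<close> are lists without leading zeros, which the list operations
  below do not preserve; here arbitrary coefficient lists are allowed.\<close>

lemma transcendental_iff_no_relation:
  assumes "subring F R" "a \<in> carrier R"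
  shows "(transcendental over F) a \<longleftrightarrow>
    (\<forall>q. set q \<subseteq> F \<longrightarrow> eval q a = \<zero> \<longrightarrow> set q \<subseteq> {\<zero>})"
proof (intro iffI allI impI)
  fix q
  assume tr: "(transcendental over F) a" and q: "set q \<subseteq> F" "eval q a = \<zero>"
  have "set q \<subseteq> carrier R" using q(1) subringE(1)[OF assms(1)] by auto
  hence "eval (normalize q) a = \<zero>" using q(2) assms(2) by (simp add: eval_normalize)
  moreover have "normalize q \<in> carrier (F[X])"
    using normalize_gives_polynomial[OF q(1)] univ_poly_carrier by blast
  ultimately have "normalize q = []" using eval_transcendental[OF tr] by blast
  thus "set q \<subseteq> {\<zero>}"
    using normalize_trick[of q] by (metis append_Nil2 set_replicate_conv_if empty_subsetI subset_refl)
next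
  assume *: "\<forall>q. set q \<subseteq> F \<longrightarrow> eval q a = \<zero> \<longrightarrow> set q \<subseteq> {\<zero>}"
  have "p = []" if "p \<in> carrier (F[X])" "eval p a = \<zero>" for p
  proof (rule ccontr)
    assume "p \<noteq> []"
    hence "set p \<subseteq> F" "hd p \<noteq> \<zero>" "hd p \<in> set p"
      using that(1) unfolding sym[OF univ_poly_carrier] polynomial_def by auto
    thus False using * that(2) by auto
  qed
  thus "(transcendental over F) a"
    using algebraicE[OF assms] unfolding over_def by metis
qed

lemma eval_map_mult:
  assumes "set q \<subseteq> carrier R" "a \<in> carrier R" "d \<in> carrier R"
  shows "eval (map ((\<otimes>) d) q) a = d \<otimes> eval q a"
  using assms by (induct q) (auto simp: eval_in_carrier r_distr m_assoc)

lemma eval_map2_add_mult: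
  assumes "length f = length g" "set f \<subseteq> carrier R" "set g \<subseteq> carrier R"
    "c \<in> carrier R" "a \<in> carrier R"
  shows "eval (map2 (\<lambda>u v. u \<oplus> c \<otimes> v) f g) a = eval f a \<oplus> c \<otimes> eval g a"
  using assms
proof (induct f g rule: list_induct2)
  case Nil thus ?case by simp
next
  case (Cons u f v g)
  have "eval f a \<in> carrier R" "eval g a \<in> carrier R" "a [^] length g \<in> carrier R"
    using Cons(3,4,6) by (auto simp: eval_in_carrier)
  moreover have "u \<in> carrier R" "v \<in> carrier R" using Cons(3,4) by auto
  moreover have "eval (map2 (\<lambda>u v. u \<oplus> c \<otimes> v) f g) a = eval f a \<oplus> c \<otimes> eval g a"
    using Cons by simp
  ultimately show ?case using Cons(1,5) by (simp add: l_distr r_distr m_assoc a_ac)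
qed

section \<open>Fractions over a subring\<close>

text \<open>Fractions are characterised by multiplication instead of inverses, so that closure under the
  field operations becomes a calculation inside \<open>M\<close>.\<close>

definition fractions :: "'a set \<Rightarrow> 'a set" where
  "fractions M = {x \<in> carrier R. \<exists>y \<in> M - {\<zero>}. x \<otimes> y \<in> M}"

lemma fractions_incl:
  assumes "subring M R" shows "M \<subseteq> fractions M"
  using subringE(1,3)[OF assms] by (auto simp: fractions_def intro!: bexI[of _ \<one>])

lemma
  assumes "x \<otimes> a = b" "y \<otimes> c = d"
    and "x \<in> carrier R" "y \<in> carrier R" "a \<in> carrier R" "c \<in> carrier R"
  shows fraction_add: "(x \<oplus> y) \<otimes> (a \<otimes> c) = b \<otimes> c \<oplus> d \<otimes> a"
    and fraction_mult: "(x \<otimes> y) \<otimes> (a \<otimes> c) = b \<otimes> d"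
  unfolding assms(1,2)[symmetric] using assms(3-) by algebra+

lemma subfield_fractions:
  assumes "subring M R" shows "subfield (fractions M) R"
proof (rule subfieldI'[OF subringI])
  note M = subringE[OF assms]
  show "fractions M \<subseteq> carrier R" by (auto simp: fractions_def)
  show "\<one> \<in> fractions M" using M(3) fractions_incl[OF assms] by auto
  show "\<ominus> x \<in> fractions M" if "x \<in> fractions M" for x
    
  proof -
    obtain y where y: "y \<in> M - {\<zero>}" "x \<otimes> y \<in> M" "x \<in> carrier R"
      using \<open>x \<in> fractions M\<close> by (auto simp: fractions_def)
    hence "\<ominus> x \<otimes> y = \<ominus> (x \<otimes> y)" using M(1) by (intro l_minus) auto
    thus ?thesis using y M(5) by (auto simp: fractions_def intro!: bexI[of _ y])
  qed
  fix x1 x2 assume "x1 \<in> fractions M" "x2 \<in> fractions M"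
  then obtain y1 y2 where y: "y1 \<in> M - {\<zero>}" "x1 \<otimes> y1 \<in> M" "x1 \<in> carrier R"
    "y2 \<in> M - {\<zero>}" "x2 \<otimes> y2 \<in> M" "x2 \<in> carrier R" by (auto simp: fractions_def)
  have c: "y1 \<in> carrier R" "y2 \<in> carrier R" using y M(1) by auto
  have y12: "y1 \<otimes> y2 \<in> M - {\<zero>}" using y M(6) c integral by auto
  have "(x1 \<otimes> x2) \<otimes> (y1 \<otimes> y2) = (x1 \<otimes> y1) \<otimes> (x2 \<otimes> y2)"
    "(x1 \<oplus> x2) \<otimes> (y1 \<otimes> y2) = (x1 \<otimes> y1) \<otimes> y2 \<oplus> (x2 \<otimes> y2) \<otimes> y1"
    using y(3,6) c by algebra+
  hence "(x1 \<otimes> x2) \<otimes> (y1 \<otimes> y2) \<in> M" "(x1 \<oplus> x2) \<otimes> (y1 \<otimes> y2) \<in> M"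
    using y M(6,7) by auto
  thus "x1 \<otimes> x2 \<in> fractions M" "x1 \<oplus> x2 \<in> fractions M"
    using y12 y(3,6) unfolding fractions_def by auto
next
  note M = subringE[OF assms]
  fix x assume "x \<in> fractions M - {\<zero>}"
  then obtain y where y: "y \<in> M - {\<zero>}" "x \<otimes> y \<in> M" "x \<in> carrier R" "x \<noteq> \<zero>"
    by (auto simp: fractions_def)
  have c: "y \<in> carrier R" using y M(1) by auto
  have u: "x \<in> Units R" using y by (simp add: field_Units)
  have "inv x \<otimes> (x \<otimes> y) = y" using u c y(3) by (simp add: m_assoc[symmetric])
  moreover have "x \<otimes> y \<noteq> \<zero>" using y c integral by auto
  ultimately show "inv x \<in> fractions M"
    using y u by (auto simp: fractions_def intro!: bexI[of _ "x \<otimes> y"])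
qed

lemma clear_denominators:
  assumes "subring M R" "set q \<subseteq> fractions M"
  shows "\<exists>d \<in> M - {\<zero>}. set (map ((\<otimes>) d) q) \<subseteq> M"
  using assms(2)
proof (induct q)
  case Nil thus ?case using subringE(3)[OF assms(1)] by force
next
  case (Cons x q)
  note M = subringE[OF assms(1)]
  obtain d where d: "d \<in> M - {\<zero>}" "set (map ((\<otimes>) d) q) \<subseteq> M" using Cons by auto
  obtain y where y: "x \<in> carrier R" "y \<in> M - {\<zero>}" "x \<otimes> y \<in> M"
    using Cons(2) by (auto simp: fractions_def)
  have c: "d \<in> carrier R" "y \<in> carrier R" using d y M(1) by auto
  have q: "set q \<subseteq> carrier R" using Cons(2) by (auto simp: fractions_def)
  have "(y \<otimes> d) \<otimes> x = d \<otimes> (x \<otimes> y)" using c y(1) by algebra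
  moreover have "(y \<otimes> d) \<otimes> z = y \<otimes> (d \<otimes> z)" if "z \<in> set q" for z
    using c that q by (auto simp: m_assoc)
  moreover have "y \<otimes> d \<in> M - {\<zero>}" using d y c M(6) integral by blast
  ultimately show ?case using d y M(6) by (intro bexI[of _ "y \<otimes> d"]) auto
qed

text \<open>Multiplying a polynomial relation by a common denominator of its coefficients gives a
  relation over \<open>M\<close>.\<close>

lemma transcendental_over_fractions:
  assumes "subring M R" "a \<in> carrier R" "(transcendental over M) a"
  shows "(transcendental over (fractions M)) a"
  unfolding transcendental_iff_no_relation[OF subfieldE(1)[OF subfield_fractions[OF assms(1)]] assms(2)]
proof (intro allI impI)
  fix q assume q: "set q \<subseteq> fractions M" "eval q a = \<zero>"
  obtain d where d: "d \<in> M - {\<zero>}" "set (map ((\<otimes>) d) q) \<subseteq> M"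
    using clear_denominators[OF assms(1) q(1)] by auto
  have c: "set q \<subseteq> carrier R" "d \<in> carrier R"
    using q(1) d(1) subringE(1)[OF assms(1)] by (auto simp: fractions_def)
  have "eval (map ((\<otimes>) d) q) a = \<zero>" using eval_map_mult[OF c(1) assms(2) c(2)] q(2) c(2) by simp
  hence "set (map ((\<otimes>) d) q) \<subseteq> {\<zero>}"
    using d(2) assms(3) transcendental_iff_no_relation[OF assms(1,2)] by blast
  hence "d \<otimes> z = \<zero>" if "z \<in> set q" for z using that by auto
  thus "set q \<subseteq> {\<zero>}" using c d(1) integral by blast
qed

section \<open>Adjoining elements\<close>

lemma adjoin_props:
  assumes "K \<subseteq> carrier R" "H \<subseteq> carrier R"
  shows "subfield (adjoin K H) R" "K \<subseteq> adjoin K H" "H \<subseteq> adjoin K H" "adjoin K H \<subseteq> carrier R"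
proof -
  have H: "K \<union> H \<subseteq> carrier R" using assms by simp
  show "subfield (adjoin K H) R" unfolding adjoin_def by (rule generate_field_is_subfield[OF H])
  thus "adjoin K H \<subseteq> carrier R" by (rule subfieldE(3))
  show "K \<subseteq> adjoin K H" "H \<subseteq> adjoin K H" unfolding adjoin_def by (auto intro: generate_field.incl)
qed

lemma adjoin_min:
  assumes "subfield E R" "K \<subseteq> E" "H \<subseteq> E" shows "adjoin K H \<subseteq> E"
  using generate_field_min_subfield1[OF _ assms(1), of "K \<union> H"] subfieldE(3)[OF assms(1)] assms(2,3)
  unfolding adjoin_def by blast

lemma adjoin_mono:
  assumes "K \<subseteq> carrier R" "H' \<subseteq> carrier R" "H \<subseteq> H'"
  shows "adjoin K H \<subseteq> adjoin K H'"
  using adjoin_props[OF assms(1,2)] assms(3) by (intro adjoin_min) auto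

lemma adjoin_insert:
  assumes "K \<subseteq> carrier R" "H \<subseteq> carrier R" "a \<in> carrier R"
  shows "adjoin K (insert a H) = adjoin (adjoin K H) {a}"
proof
  note H = adjoin_props[OF assms(1,2)]
  note aH = adjoin_props[of "adjoin K H" "{a}"]
  note i = adjoin_props[of K "insert a H"]
  show "adjoin K (insert a H) \<subseteq> adjoin (adjoin K H) {a}"
    using H aH assms by (intro adjoin_min) auto
  have "adjoin K H \<subseteq> adjoin K (insert a H)" using assms by (intro adjoin_mono) auto
  thus "adjoin (adjoin K H) {a} \<subseteq> adjoin K (insert a H)"
    using i assms by (intro adjoin_min) auto
qed

lemma adjoin_finitary:
  assumes "K \<subseteq> carrier R" "H \<subseteq> carrier R" "x \<in> adjoin K H"
  shows "\<exists>D. finite D \<and> D \<subseteq> H \<and> x \<in> adjoin K D"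
proof -
  have mono: "adjoin K D \<subseteq> adjoin K D'" if "D \<subseteq> D'" "D' \<subseteq> H" for D D'
    using that assms by (intro adjoin_mono) auto
  from assms(3)[unfolded adjoin_def] show ?thesis
  proof (induct rule: generate_field.induct)
    case one
    show ?case by (intro exI[of _ "{}"]) (auto simp: adjoin_def generate_field.one)
  next
    case (incl h)
    show ?case
      using incl by (intro exI[of _ "{h} \<inter> H"]) (auto simp: adjoin_def intro: generate_field.incl)
  next
    case (a_inv h)
    thus ?case unfolding adjoin_def by (blast intro: generate_field.a_inv)
  next
    case (m_inv h)
    thus ?case unfolding adjoin_def by (blast intro: generate_field.m_inv)
  next
    case (eng_add x y)
    then obtain C D where "finite C" "C \<subseteq> H" "x \<in> adjoin K C" "finite D" "D \<subseteq> H" "y \<in> adjoin K D"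
      by auto
    moreover from this have "x \<in> adjoin K (C \<union> D)" "y \<in> adjoin K (C \<union> D)"
      using mono[of C "C \<union> D"] mono[of D "C \<union> D"] by auto
    ultimately show ?case
      by (intro exI[of _ "C \<union> D"]) (auto simp: adjoin_def intro: generate_field.eng_add)
  next
    case (eng_mult x y)
    then obtain C D where "finite C" "C \<subseteq> H" "x \<in> adjoin K C" "finite D" "D \<subseteq> H" "y \<in> adjoin K D"
      by auto
    moreover from this have "x \<in> adjoin K (C \<union> D)" "y \<in> adjoin K (C \<union> D)"
      using mono[of C "C \<union> D"] mono[of D "C \<union> D"] by auto
    ultimately show ?case
      by (intro exI[of _ "C \<union> D"]) (auto simp: adjoin_def intro: generate_field.eng_mult)
  qed
qed

lemma adjoin_singleton_fraction:
  assumes "subfield F R" "t \<in> carrier R" "x \<in> adjoin F {t}"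
  obtains f g where "f \<in> carrier (F[X])" "g \<in> carrier (F[X])" "eval g t \<noteq> \<zero>"
    "x \<otimes> eval g t = eval f t"
proof -
  let ?M = "simple_extension F t"
  note F = subfieldE(1,3)[OF assms(1)]
  have M: "subring ?M R" by (rule simple_extension_is_subring[OF F(1) assms(2)])
  have "F \<subseteq> ?M" "t \<in> ?M"
    using simple_extension_incl[OF F(2) assms(2)] simple_extension_mem[OF F(1) assms(2)] by auto
  hence "adjoin F {t} \<subseteq> fractions ?M"
    using fractions_incl[OF M] by (intro adjoin_min subfield_fractions M) auto
  then obtain y where "y \<in> ?M - {\<zero>}" "x \<otimes> y \<in> ?M" using assms(3) by (auto simp: fractions_def)
  thus thesis using that unfolding simple_extension_as_eval_img[OF F(2) assms(2)] by auto
qed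

section \<open>Adjoining one transcendental element\<close>

text \<open>If \<open>x = f(t) / g(t)\<close> lies in \<open>E\<close>, then \<open>f - x g\<close> is a polynomial over \<open>E\<close> with root \<open>t\<close>, so all
  its coefficients vanish, and \<open>x\<close> is the quotient of two corresponding coefficients of \<open>f\<close> and \<open>g\<close>.\<close>

lemma adjoin_transcendental_Int:
  assumes F: "subfield F R" and E: "subfield E R" and "F \<subseteq> E"
    and t: "t \<in> carrier R" "(transcendental over E) t"
    and x: "x \<in> E" "x \<in> adjoin F {t}"
  shows "x \<in> F"
proof -
  obtain f g where fg: "f \<in> carrier (F[X])" "g \<in> carrier (F[X])" "eval g t \<noteq> \<zero>"
    "x \<otimes> eval g t = eval f t"
    by (rule adjoin_singleton_fraction[OF F t(1) x(2)])
  \<comment> \<open>Leading zeros bring both coefficient lists to the same length.\<close>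
  define f' where "f' = replicate (length g - length f) \<zero> @ f"
  define g' where "g' = replicate (length f - length g) \<zero> @ g"
  have len: "length f' = length g'" by (auto simp: f'_def g'_def)
  have FR: "F \<subseteq> carrier R" and z: "\<zero> \<in> F" using F subfieldE(3) subringE(2)[OF subfieldE(1)] by auto
  have "set f \<subseteq> F" "set g \<subseteq> F" using fg(1,2) polynomial_incl univ_poly_carrier by blast+
  hence sF: "set f' \<subseteq> F" "set g' \<subseteq> F" using z by (auto simp: f'_def g'_def)
  hence sR: "set f' \<subseteq> carrier R" "set g' \<subseteq> carrier R" using FR by auto
  have ev: "eval f' t = eval f t" "eval g' t = eval g t"
    using \<open>set f \<subseteq> F\<close> \<open>set g \<subseteq> F\<close> FR t(1) unfolding f'_def g'_def by (auto intro!: eval_replicate)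
  have xR: "x \<in> carrier R" using x(1) E subfieldE(3) by auto
  let ?h = "map2 (\<lambda>u v. u \<oplus> \<ominus> x \<otimes> v) f' g'"
  have gR: "eval g t \<in> carrier R" using ev(2) eval_in_carrier[OF sR(2) t(1)] by simp
  have "eval ?h t = eval f t \<oplus> \<ominus> x \<otimes> eval g t"
    using eval_map2_add_mult[OF len sR a_inv_closed[OF xR] t(1)] ev by simp
  also have "\<dots> = x \<otimes> eval g t \<oplus> \<ominus> x \<otimes> eval g t" by (simp only: fg(4))
  also have "\<dots> = \<zero>" using xR gR by algebra
  finally have "eval ?h t = \<zero>" .
  moreover have "set ?h \<subseteq> E"
  proof
    fix y assume "y \<in> set ?h"
    then obtain u v where "(u, v) \<in> set (zip f' g')" and y: "y = u \<oplus> \<ominus> x \<otimes> v" by auto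
    hence "u \<in> set f'" "v \<in> set g'" by (auto dest: set_zip_leftD set_zip_rightD)
    hence "u \<in> E" "v \<in> E" using sF assms(3) by auto
    thus "y \<in> E" using y x(1) subringE(5,6,7)[OF subfieldE(1)[OF E]] by simp
  qed
  ultimately have h0: "set ?h \<subseteq> {\<zero>}"
    using t(2) transcendental_iff_no_relation[OF subfieldE(1)[OF E] t(1)] by blast
  have "\<not> set g' \<subseteq> {\<zero>}"
  proof
    assume "set g' \<subseteq> {\<zero>}"
    hence "g' = replicate (length g') \<zero> @ []" 
      by (metis append_Nil2 replicate_length_same singletonD subsetD)
    hence "eval g' t = \<zero>" using eval_replicate[of "[]" t "length g'"] t(1) by simp
    thus False using ev fg(3) by simp
  qed
  then obtain i where i: "i < length g'" "g' ! i \<noteq> \<zero>" by (metis in_set_conv_nth insertI1 subsetI)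
  hence gi: "g' ! i \<in> F - {\<zero>}" "f' ! i \<in> F" using sF len nth_mem by auto
  have "?h ! i \<in> set ?h" using i(1) len by (intro nth_mem) simp
  hence "?h ! i = \<zero>" using h0 by blast
  hence "f' ! i \<oplus> \<ominus> x \<otimes> g' ! i = \<zero>" using i(1) len by simp
  moreover have c: "f' ! i \<in> carrier R" "g' ! i \<in> carrier R" using gi FR by auto
  ultimately have "f' ! i \<ominus> x \<otimes> g' ! i = \<zero>" using xR by (simp add: a_minus_def l_minus)
  hence "g' ! i \<otimes> x = f' ! i" using c xR by (simp add: r_right_minus_eq m_comm)
  thus ?thesis using subfield_m_inv_simprule[OF F gi(1) xR] gi(2) by simp
qed

section \<open>Translations of a transcendental generator\<close>

text \<open>Evaluation at \<open>t\<close> and at \<open>s\<close> are both injective on \<open>F[X]\<close>, so \<open>f(t) / g(t) \<mapsto> f(s) / g(s)\<close> is a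
  well-defined bijection. It is handled as the relation \<open>rel\<close>, which is symmetric in \<open>t\<close> and \<open>s\<close>
  and compatible with the field operations; being a bijective function then reduces to
  \<open>zero_iff\<close>, that \<open>0\<close> is related to \<open>0\<close> only.\<close>

lemma adjoin_transcendental_automorphism:
  assumes F: "subfield F R"
    and t: "t \<in> carrier R" "(transcendental over F) t" "carrier R = adjoin F {t}"
    and s: "s \<in> carrier R" "(transcendental over F) s" "carrier R = adjoin F {s}"
  shows "\<exists>\<sigma>\<in>Gal F. \<sigma> t = s"
proof -
  have FR: "subring F R" by (rule subfieldE(1)[OF F])
  interpret P: domain "F[X]" by (rule univ_poly_is_domain[OF FR])
  interpret T: ring_hom_ring "F[X]" R "\<lambda>p. eval p t" by (rule eval_ring_hom[OF FR t(1)])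
  interpret S: ring_hom_ring "F[X]" R "\<lambda>p. eval p s" by (rule eval_ring_hom[OF FR s(1)])
  have ev [simp]: "eval p t \<in> carrier R" "eval p s \<in> carrier R" if "p \<in> carrier (F[X])" for p
    using that T.hom_closed S.hom_closed by auto
  have nz: "eval p t \<noteq> \<zero> \<longleftrightarrow> p \<noteq> \<zero>\<^bsub>F[X]\<^esub>" "eval p s \<noteq> \<zero> \<longleftrightarrow> p \<noteq> \<zero>\<^bsub>F[X]\<^esub>"
    if "p \<in> carrier (F[X])" for p
    using that eval_transcendental[OF t(2), of p] eval_transcendental[OF s(2), of p]
    by (auto simp: univ_poly_zero)
  define rel where "rel x y \<longleftrightarrow> x \<in> carrier R \<and> y \<in> carrier R \<and>
    (\<exists>f \<in> carrier (F[X]). \<exists>g \<in> carrier (F[X]). g \<noteq> \<zero>\<^bsub>F[X]\<^esub> \<and>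
       x \<otimes> eval g t = eval f t \<and> y \<otimes> eval g s = eval f s)" for x y
  have relI: "rel x y" if "x \<in> carrier R" "y \<in> carrier R" "f \<in> carrier (F[X])" "g \<in> carrier (F[X])"
    "g \<noteq> \<zero>\<^bsub>F[X]\<^esub>" "x \<otimes> eval g t = eval f t" "y \<otimes> eval g s = eval f s" for x y f g
    using that unfolding rel_def by blast
  have ex1: "\<exists>y. rel x y" if x: "x \<in> carrier R" for x
  proof -
    obtain f g where fg: "f \<in> carrier (F[X])" "g \<in> carrier (F[X])" "eval g t \<noteq> \<zero>"
      "x \<otimes> eval g t = eval f t"
      using adjoin_singleton_fraction[OF F t(1)] x t(3) by metis
    hence gs: "eval g s \<in> Units R" using nz by (auto simp: field_Units)
    hence "eval f s \<otimes> inv (eval g s) \<otimes> eval g s = eval f s"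
      using fg(1,2) by (simp add: m_assoc)
    thus ?thesis using fg gs nz x by (intro exI[of _ "eval f s \<otimes> inv (eval g s)"] relI[of _ _ f g]) auto
  qed
  have ex2: "\<exists>x. rel x y" if y: "y \<in> carrier R" for y
  proof -
    obtain f g where fg: "f \<in> carrier (F[X])" "g \<in> carrier (F[X])" "eval g s \<noteq> \<zero>"
      "y \<otimes> eval g s = eval f s"
      using adjoin_singleton_fraction[OF F s(1)] y s(3) by metis
    hence gt: "eval g t \<in> Units R" using nz by (auto simp: field_Units)
    hence "eval f t \<otimes> inv (eval g t) \<otimes> eval g t = eval f t"
      using fg(1,2) by (simp add: m_assoc)
    thus ?thesis using fg gt nz y by (intro exI[of _ "eval f t \<otimes> inv (eval g t)"] relI[of _ _ f g]) auto
  qed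
  have zero_iff: "x = \<zero> \<longleftrightarrow> y = \<zero>" if r: "rel x y" for x y
  proof -
    obtain f g where fg: "f \<in> carrier (F[X])" "g \<in> carrier (F[X])" "g \<noteq> \<zero>\<^bsub>F[X]\<^esub>"
      "x \<otimes> eval g t = eval f t" "y \<otimes> eval g s = eval f s" "x \<in> carrier R" "y \<in> carrier R"
      using r unfolding rel_def by blast
    have "x \<otimes> eval g t = \<zero> \<longleftrightarrow> x = \<zero>" "y \<otimes> eval g s = \<zero> \<longleftrightarrow> y = \<zero>"
      using fg(2,3,6,7) nz[OF fg(2)] by (simp_all add: integral_iff)
    hence "x = \<zero> \<longleftrightarrow> eval f t = \<zero>" "y = \<zero> \<longleftrightarrow> eval f s = \<zero>"
      by (simp_all only: fg(4,5))
    thus ?thesis using nz[OF fg(1)] by blast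
  qed
  have ops: "rel (x1 \<oplus> x2) (y1 \<oplus> y2)" "rel (x1 \<otimes> x2) (y1 \<otimes> y2)"
    if r: "rel x1 y1" "rel x2 y2" for x1 y1 x2 y2
  proof -
    obtain f1 g1 where 1: "f1 \<in> carrier (F[X])" "g1 \<in> carrier (F[X])" "g1 \<noteq> \<zero>\<^bsub>F[X]\<^esub>"
      "x1 \<otimes> eval g1 t = eval f1 t" "y1 \<otimes> eval g1 s = eval f1 s" "x1 \<in> carrier R" "y1 \<in> carrier R"
      using r(1) unfolding rel_def by blast
    obtain f2 g2 where 2: "f2 \<in> carrier (F[X])" "g2 \<in> carrier (F[X])" "g2 \<noteq> \<zero>\<^bsub>F[X]\<^esub>"
      "x2 \<otimes> eval g2 t = eval f2 t" "y2 \<otimes> eval g2 s = eval f2 s" "x2 \<in> carrier R" "y2 \<in> carrier R"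
      using r(2) unfolding rel_def by blast
    have g: "g1 \<otimes>\<^bsub>F[X]\<^esub> g2 \<in> carrier (F[X])" "g1 \<otimes>\<^bsub>F[X]\<^esub> g2 \<noteq> \<zero>\<^bsub>F[X]\<^esub>"
      using 1(2,3) 2(2,3) P.integral by auto
    note c = 1(6,7) 2(6,7) ev[OF 1(2)] ev[OF 2(2)]
    show "rel (x1 \<oplus> x2) (y1 \<oplus> y2)"
    proof (rule relI[OF _ _ _ g])
      show "f1 \<otimes>\<^bsub>F[X]\<^esub> g2 \<oplus>\<^bsub>F[X]\<^esub> f2 \<otimes>\<^bsub>F[X]\<^esub> g1 \<in> carrier (F[X])"
        using 1(1,2) 2(1,2) by simp
    qed (use 1(1,2) 2(1,2) c fraction_add[OF 1(4) 2(4)] fraction_add[OF 1(5) 2(5)] in simp_all)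
    show "rel (x1 \<otimes> x2) (y1 \<otimes> y2)"
    proof (rule relI[OF _ _ _ g])
      show "f1 \<otimes>\<^bsub>F[X]\<^esub> f2 \<in> carrier (F[X])" using 1(1) 2(1) by simp
    qed (use 1(1,2) 2(1,2) c fraction_mult[OF 1(4) 2(4)] fraction_mult[OF 1(5) 2(5)] in simp_all)
  qed
  have const: "rel c c" if c: "c \<in> F" for c
  proof -
    have "c \<in> carrier R" using c subfieldE(3)[OF F] by auto
    have p: "normalize [c] \<in> carrier (F[X])"
      unfolding univ_poly_carrier[symmetric] by (rule normalize_gives_polynomial) (simp add: c)
    have e: "eval (normalize [c]) a = c" if "a \<in> carrier R" for a
      using that \<open>c \<in> carrier R\<close> eval_normalize[of "[c]" a] by simp
    show ?thesis
      by (rule relI[OF _ _ p P.one_closed P.one_not_zero])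
        (use \<open>c \<in> carrier R\<close> e t(1) s(1) in simp_all)
  qed
  have ts: "rel t s"
    by (rule relI[OF _ _ var_closed(1)[OF FR] P.one_closed P.one_not_zero])
      (use t(1) s(1) in \<open>simp_all add: eval_var\<close>)
  have rc: "x \<in> carrier R" "y \<in> carrier R" if "rel x y" for x y using that by (auto simp: rel_def)
  have minus: "rel (x1 \<ominus> x2) (y1 \<ominus> y2)" if r: "rel x1 y1" "rel x2 y2" for x1 y1 x2 y2
  proof -
    have "rel (\<ominus> \<one>) (\<ominus> \<one>)" using const subringE(3,5)[OF FR] by blast
    from ops(1)[OF r(1) ops(2)[OF this r(2)]] show ?thesis
      using rc r by (simp add: l_minus a_minus_def)
  qed
  have inj: "x1 = x2 \<longleftrightarrow> y1 = y2" if r: "rel x1 y1" "rel x2 y2" for x1 y1 x2 y2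
    using zero_iff[OF minus[OF r]] rc r by simp
  define \<sigma> where "\<sigma> x = (SOME y. rel x y)" for x
  have \<sigma>: "rel x (\<sigma> x)" if "x \<in> carrier R" for x
    unfolding \<sigma>_def using someI_ex[OF ex1[OF that]] .
  have \<sigma>_eq: "\<sigma> x = y" if "rel x y" for x y using inj[OF \<sigma> that] rc that by auto
  have "\<sigma> \<in> ring_hom R R"
    using \<sigma> rc(2)[OF \<sigma>] const[OF subringE(3)[OF FR]] by (intro ring_hom_memI \<sigma>_eq ops) auto
  moreover have "bij_betw \<sigma> (carrier R) (carrier R)"
  proof (rule bij_betwI')
    fix x y assume "x \<in> carrier R" "y \<in> carrier R"
    thus "\<sigma> x = \<sigma> y \<longleftrightarrow> x = y" using inj \<sigma> by blast
  next
    fix x assume "x \<in> carrier R" thus "\<sigma> x \<in> carrier R" using \<sigma> rc by blast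
  next
    fix y assume "y \<in> carrier R"
    then obtain x where "rel x y" using ex2 by blast
    thus "\<exists>x\<in>carrier R. y = \<sigma> x" using \<sigma>_eq rc by blast
  qed
  ultimately have "\<sigma> \<in> Gal F" using const \<sigma>_eq by (auto simp: Gal_def ring_iso_def)
  thus ?thesis using \<sigma>_eq[OF ts] by blast
qed

lemma subfield_fixed:
  assumes "G \<subseteq> ring_iso R R"
  shows "subfield {x \<in> carrier R. \<forall>\<sigma>\<in>G. \<sigma> x = x} R"
proof (rule subfieldI'[OF subringI])
  let ?E = "{x \<in> carrier R. \<forall>\<sigma>\<in>G. \<sigma> x = x}"
  have hom: "\<sigma> \<in> ring_hom R R" if "\<sigma> \<in> G" for \<sigma>
    using that assms by (auto simp: ring_iso_def)
  have E: "x \<in> ?E \<longleftrightarrow> x \<in> carrier R \<and> (\<forall>\<sigma>\<in>G. \<sigma> x = x)" for x by simp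
  show "?E \<subseteq> carrier R" by auto
  show "\<one> \<in> ?E" using ring_hom_one[OF hom] unfolding E by simp
  show "\<ominus> x \<in> ?E" if "x \<in> ?E" for x
  proof -
    have "\<sigma> (\<ominus> x) = \<ominus> x" if "\<sigma> \<in> G" for \<sigma>
    proof -
      interpret ring_hom_ring R R \<sigma> by (intro ring_hom_ringI2 ring_axioms hom[OF that])
      have "\<sigma> x = x" using \<open>x \<in> ?E\<close> that by simp
      thus ?thesis using hom_a_inv[of x] \<open>x \<in> ?E\<close> by simp
    qed
    moreover have "\<ominus> x \<in> carrier R" using that by simp
    ultimately show ?thesis unfolding E by blast
  qed
  show "x \<otimes> y \<in> ?E" "x \<oplus> y \<in> ?E" if "x \<in> ?E" "y \<in> ?E" for x y
    using that ring_hom_mult[OF hom, of _ x y] ring_hom_add[OF hom, of _ x y] unfolding E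
    by (metis m_closed, metis add.m_closed)
next
  fix x
  let ?E = "{x \<in> carrier R. \<forall>\<sigma>\<in>G. \<sigma> x = x}"
  assume x: "x \<in> ?E - {\<zero>}"
  hence xU: "x \<in> Units R" by (auto simp: field_Units)
  have "\<sigma> (inv x) = inv x" if s: "\<sigma> \<in> G" for \<sigma>
  proof -
    have hom: "\<sigma> \<in> ring_hom R R" using s assms by (auto simp: ring_iso_def)
    have c: "\<sigma> (inv x) \<in> carrier R" using ring_hom_closed[OF hom] xU by simp
    have "\<sigma> x = x" using x s by blast
    hence "x \<otimes> \<sigma> (inv x) = \<sigma> (x \<otimes> inv x)"
      using xU Units_closed[OF xU] ring_hom_mult[OF hom, of x "inv x"] by (simp del: Units_r_inv)
    also have "\<dots> = \<one>" using xU ring_hom_one[OF hom] by simp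
    finally show ?thesis using comm_inv_char[OF Units_closed[OF xU] c] by simp
  qed
  moreover have "inv x \<in> carrier R" using xU by simp
  ultimately show "inv x \<in> ?E" by blast
qed

lemma subring_add_cancel:
  assumes "subring E R" "t \<in> carrier R" "t \<oplus> c \<in> E" "c \<in> E"
  shows "t \<in> E"
proof -
  have "(t \<oplus> c) \<oplus> \<ominus> c \<in> E" using subringE(5,7)[OF assms(1)] assms(3,4) by blast
  thus ?thesis using assms(2) subringE(1)[OF assms(1)] assms(4) by (auto simp: a_assoc r_neg)
qed

text \<open>A polynomial over the fixed field \<open>E\<close> of \<open>Gal F\<close> that vanishes at \<open>t\<close> also vanishes at all
  translates \<open>t + c\<close> with \<open>c \<in> F\<close>. There are infinitely many of them, so \<open>t\<close> is transcendental over \<open>E\<close>.\<close>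

lemma galois_adjoin_transcendental:
  assumes F: "subfield F R" "infinite F"
    and t: "t \<in> carrier R" "(transcendental over F) t" "carrier R = adjoin F {t}"
  shows "galois F"
proof -
  define E where "E = {x \<in> carrier R. \<forall>\<sigma>\<in>Gal F. \<sigma> x = x}"
  have E: "subfield E R" unfolding E_def by (rule subfield_fixed) (auto simp: Gal_def)
  have FR: "F \<subseteq> carrier R" by (rule subfieldE(3)[OF F(1)])
  have FE: "F \<subseteq> E" using FR by (auto simp: E_def Gal_def)
  have translate: "\<exists>\<sigma>\<in>Gal F. \<sigma> t = t \<oplus> c" if c: "c \<in> F" for c
  proof (rule adjoin_transcendental_automorphism[OF F(1) t])
    have cR: "c \<in> carrier R" using c FR by auto
    thus s: "t \<oplus> c \<in> carrier R" using t(1) by simp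
    \<comment> \<open>The elements algebraic over \<open>F\<close> form a field containing \<open>c\<close>, so \<open>t + c\<close> is not among them.\<close>
    show "(transcendental over F) (t \<oplus> c)"
    proof (rule ccontr)
      let ?A = "{x \<in> carrier R. (algebraic over F) x}"
      assume "\<not> (transcendental over F) (t \<oplus> c)"
      hence "t \<oplus> c \<in> ?A" using s by (simp add: over_def)
      moreover have "c \<in> ?A" using algebraic_self[OF subfieldE(1)[OF F(1)] c] cR by simp
      ultimately have "t \<in> ?A"
        by (rule subring_add_cancel[OF subfieldE(1)[OF subfield_of_algebraics[OF F(1)]] t(1)])
      thus False using t(2) by (simp add: over_def)
    qed
    note A = adjoin_props[OF FR, of "{t \<oplus> c}"]
    have "t \<oplus> c \<in> adjoin F {t \<oplus> c}" "c \<in> adjoin F {t \<oplus> c}" using A s c by auto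
    moreover have "subring (adjoin F {t \<oplus> c}) R" using A(1) s subfieldE(1) by auto
    ultimately have "t \<in> adjoin F {t \<oplus> c}" using subring_add_cancel[OF _ t(1)] by blast
    hence "adjoin F {t} \<subseteq> adjoin F {t \<oplus> c}" using A s by (intro adjoin_min) auto
    thus "carrier R = adjoin F {t \<oplus> c}" using A(4) s t(3) by auto
  qed
  have "(transcendental over E) t"
    unfolding transcendental_iff_no_relation[OF subfieldE(1)[OF E] t(1)]
  proof (intro allI impI, rule ccontr)
    fix q assume q: "set q \<subseteq> E" "eval q t = \<zero>" "\<not> set q \<subseteq> {\<zero>}"
    have qR: "set q \<subseteq> carrier R" using q(1) by (auto simp: E_def)
    have root: "eval q (t \<oplus> c) = \<zero>" if c: "c \<in> F" for c
    proof -
      obtain \<sigma> where \<sigma>: "\<sigma> \<in> Gal F" "\<sigma> t = t \<oplus> c" using translate[OF c] by blast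
      interpret ring_hom_ring R R \<sigma>
        using \<sigma>(1) by (intro ring_hom_ringI2 ring_axioms) (auto simp: Gal_def ring_iso_def)
      have "map \<sigma> q = q" using q(1) \<sigma>(1) by (intro map_idI) (auto simp: E_def)
      thus ?thesis using eval_hom'[OF t(1) qR] \<sigma>(2) q(2) by simp
    qed
    have "normalize q \<noteq> []"
      using q(3) normalize_trick[of q] by (metis append_Nil2 set_replicate_conv_if empty_subsetI subset_refl)
    moreover have "normalize q \<in> carrier (poly_ring R)"
      using normalize_gives_polynomial[OF qR] univ_poly_carrier by blast
    ultimately have "(\<lambda>c. t \<oplus> c) ` F \<subseteq> {a. is_root (normalize q) a}"
      using root FR t(1) qR by (auto simp: is_root_def eval_normalize)
    hence "finite ((\<lambda>c. t \<oplus> c) ` F)"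
      using finite_number_of_roots[OF \<open>normalize q \<in> carrier (poly_ring R)\<close>] finite_subset by blast
    moreover have "inj_on (\<lambda>c. t \<oplus> c) F" 
      using FR t(1) by (intro inj_onI) (metis add.l_cancel subsetD)
    ultimately show False using F(2) finite_imageD by blast
  qed
  hence "E \<subseteq> F"
    using adjoin_transcendental_Int[OF F(1) E FE t(1)] t(3) by (auto simp: E_def)
  thus ?thesis using FE unfolding galois_def E_def by auto
qed

section \<open>Algebraic elements\<close>

text \<open>The coefficients of an equation for \<open>a\<close> over \<open>E\<close> generate a finite extension of \<open>F\<close>, over which
  \<open>a\<close> is algebraic; degrees multiply in towers.\<close>

lemma algebraic_trans:
  assumes F: "subfield F R" and E: "subfield E R" "\<And>x. x \<in> E \<Longrightarrow> (algebraic over F) x"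
    and a: "a \<in> carrier R" "(algebraic over E) a"
  shows "(algebraic over F) a"
proof -
  obtain p where p: "p \<in> carrier (E[X])" "p \<noteq> []" "eval p a = \<zero>"
    by (rule algebraicE[OF subfieldE(1)[OF E(1)] a])
  have pE: "set p \<subseteq> E" "hd p \<noteq> \<zero>" using p(1,2) unfolding sym[OF univ_poly_carrier] polynomial_def by auto
  have pR: "set p \<subseteq> carrier R" using pE subfieldE(3)[OF E(1)] by auto
  have alg: "\<And>x. x \<in> set p \<Longrightarrow> (algebraic over F) x" using pE E(2) by auto
  let ?C = "finite_extension F p"
  have C: "subfield ?C R" by (rule finite_extension_is_subfield[OF F pR alg])
  have dim: "finite_dimension F ?C" by (rule finite_extension_finite_dimension(1)[OF F pR alg])
  have "set p \<subseteq> ?C" by (rule finite_extension_mem[OF subfieldE(1)[OF F] pR])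
  hence "p \<in> carrier (?C[X])" using pE unfolding sym[OF univ_poly_carrier] polynomial_def by auto
  hence "(algebraic over ?C) a" using p(2,3) by (intro algebraicI)
  hence "finite_dimension ?C (simple_extension ?C a)"
    using finite_dimension_simple_extension[OF C a(1)] by simp
  hence "finite_dimension F (simple_extension ?C a)" by (rule telescopic_base_dim(1)[OF F C dim])
  thus ?thesis
    using finite_dimension_imp_algebraic[OF F simple_extension_is_subring[OF subfieldE(1)[OF C] a(1)]]
      simple_extension_mem[OF subfieldE(1)[OF C] a(1)] by blast
qed

text \<open>By transitivity, \<open>t\<close> remains transcendental over the field of all elements algebraic over \<open>F\<close>.\<close>

lemma algebraic_in_adjoin_transcendental:
  assumes F: "subfield F R" and t: "t \<in> carrier R" "(transcendental over F) t"
    and x: "x \<in> adjoin F {t}" "(algebraic over F) x"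
  shows "x \<in> F"
proof -
  let ?A = "{x \<in> carrier R. (algebraic over F) x}"
  have FR: "F \<subseteq> carrier R" by (rule subfieldE(3)[OF F])
  have A: "subfield ?A R" by (rule subfield_of_algebraics[OF F])
  have FA: "F \<subseteq> ?A" using algebraic_self[OF subfieldE(1)[OF F]] FR by auto
  have "(transcendental over ?A) t"
    using algebraic_trans[OF F A _ t(1)] t(2) by (auto simp: over_def)
  thus ?thesis
    using adjoin_transcendental_Int[OF F A FA t(1) _ _ x(1)] adjoin_props(4)[OF FR, of "{t}"] x t(1) by auto
qed

section \<open>Algebraically independent sets\<close>

definition monomial :: "'a multiset \<Rightarrow> 'a" where
  "monomial m = (\<Otimes>x\<in>set_mset m. x [^] count m x)"

lemma monomial_closed:
  assumes "set_mset m \<subseteq> carrier R" shows "monomial m \<in> carrier R"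
  using assms unfolding monomial_def by (intro finprod_closed) auto

lemma monomial_add_mset:
  assumes "set_mset m \<subseteq> carrier R" "i \<in> carrier R"
  shows "monomial (add_mset i m) = monomial m \<otimes> i"
proof -
  let ?f = "\<lambda>m x. x [^] count m x"
  let ?A = "set_mset m - {i}"
  have f: "?f m \<in> ?A \<rightarrow> carrier R" using assms by auto
  have "(\<Otimes>x\<in>?A. ?f (add_mset i m) x) = (\<Otimes>x\<in>?A. ?f m x)"
    using f by (intro finprod_cong') auto
  moreover have "finprod R (?f (add_mset i m)) (insert i ?A) =
      ?f (add_mset i m) i \<otimes> finprod R (?f (add_mset i m)) ?A"
    using assms by (intro finprod_insert) auto
  moreover have "insert i ?A = set_mset (add_mset i m)" by auto
  ultimately have "monomial (add_mset i m) = i [^] Suc (count m i) \<otimes> (\<Otimes>x\<in>?A. ?f m x)"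
    unfolding monomial_def by simp
  moreover have "monomial m = i [^] count m i \<otimes> (\<Otimes>x\<in>?A. ?f m x)"
  proof (cases "i \<in># m")
    case True
    thus ?thesis unfolding monomial_def using f assms finprod_insert[of ?A i "?f m"]
      by (simp add: insert_absorb)
  next
    case False
    thus ?thesis unfolding monomial_def using f by (simp add: not_in_iff[THEN iffD1])
  qed
  moreover have "(\<Otimes>x\<in>?A. ?f m x) \<in> carrier R" using f by (rule finprod_closed)
  ultimately show ?thesis using assms by (simp add: m_ac)
qed

lemma indexed_pset_props:
  assumes "K \<subseteq> carrier R" "P \<in> indexed_pset I K"
  shows "carrier_coeff P" "finite {m. P m \<noteq> \<zero>}" "\<And>m. P m \<noteq> \<zero> \<Longrightarrow> set_mset m \<subseteq> I"
proof -
  show "carrier_coeff P" by (rule indexed_pset_in_carrier[OF assms])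
  have "finite {m. P m \<noteq> \<zero>} \<and> (\<forall>m. P m \<noteq> \<zero> \<longrightarrow> set_mset m \<subseteq> I)" using assms(2)
  proof induct
    case (indexed_const k)
    have "{m. indexed_const k m \<noteq> \<zero>} \<subseteq> {{#}}" by (auto simp: indexed_const_def)
    thus ?case by (auto simp: indexed_const_def finite_subset)
  next
    case (indexed_padd P Q)
    have "{m. indexed_padd P Q m \<noteq> \<zero>} \<subseteq> {m. P m \<noteq> \<zero>} \<union> {m. Q m \<noteq> \<zero>}"
      by (auto simp: indexed_padd_def)
    thus ?case using indexed_padd finite_subset by blast
  next
    case (indexed_pmult P i)
    have "{m. indexed_pmult P i m \<noteq> \<zero>} \<subseteq> add_mset i ` {m. P m \<noteq> \<zero>}"
      by (auto simp: indexed_pmult_def image_iff dest!: multi_member_split split: if_splits)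
    moreover have "finite (add_mset i ` {m. P m \<noteq> \<zero>})" using indexed_pmult by simp
    ultimately have "finite {m. indexed_pmult P i m \<noteq> \<zero>}" by (rule finite_subset)
    moreover have "set_mset m \<subseteq> I" if "indexed_pmult P i m \<noteq> \<zero>" for m
    proof -
      have "i \<in># m" "P (m - {#i#}) \<noteq> \<zero>" using that by (auto simp: indexed_pmult_def split: if_splits)
      hence "set_mset (m - {#i#}) \<subseteq> I" using indexed_pmult(2) by blast
      moreover have "set_mset m = insert i (set_mset (m - {#i#}))"
        using \<open>i \<in># m\<close> by (metis insert_DiffM set_mset_add_mset_insert)
      ultimately show ?thesis using indexed_pmult(3) by simp
    qed
    ultimately show ?case by blast
  qed
  thus "finite {m. P m \<noteq> \<zero>}" "\<And>m. P m \<noteq> \<zero> \<Longrightarrow> set_mset m \<subseteq> I" by auto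
qed

text \<open>A summation domain chosen in advance lets evaluations of different polynomials be added
  term by term.\<close>

lemma self_eval_superset:
  assumes K: "K \<subseteq> carrier R" "I \<subseteq> carrier R" and P: "P \<in> indexed_pset I K"
    and A: "finite A" "{m. P m \<noteq> \<zero>} \<subseteq> A" "\<And>m. m \<in> A \<Longrightarrow> set_mset m \<subseteq> carrier R"
  shows "self_eval P = (\<Oplus>m\<in>A. P m \<otimes> monomial m)"
  unfolding self_eval_def monomial_def[symmetric]
proof (rule add.finprod_mono_neutral_cong_left[OF A(1,2)])
  show "(\<lambda>m. P m \<otimes> monomial m) \<in> A \<rightarrow> carrier R"
    using monomial_closed A(3) carrier_coeffE[OF indexed_pset_props(1)[OF K(1) P]] by auto
  show "P m \<otimes> monomial m = \<zero>" if "m \<in> A - {m. P m \<noteq> \<zero>}" for m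
    using that monomial_closed A(3) by simp
qed auto

lemma
  assumes K: "K \<subseteq> carrier R" "I \<subseteq> carrier R"
  shows self_eval_const: "k \<in> K \<Longrightarrow> self_eval (indexed_const k) = k"
    and self_eval_padd: "\<lbrakk>P \<in> indexed_pset I K; Q \<in> indexed_pset I K\<rbrakk>
      \<Longrightarrow> self_eval (indexed_padd P Q) = self_eval P \<oplus> self_eval Q"
    and self_eval_pmult: "\<lbrakk>P \<in> indexed_pset I K; i \<in> I\<rbrakk>
      \<Longrightarrow> self_eval (indexed_pmult P i) = self_eval P \<otimes> i"
    and self_eval_closed: "P \<in> indexed_pset I K \<Longrightarrow> self_eval P \<in> carrier R"
proof -
  note supp = indexed_pset_props[OF K(1)]
  have mc: "set_mset m \<subseteq> carrier R" if "P m \<noteq> \<zero>" "P \<in> indexed_pset I K" for m P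
    using supp(3)[OF that(2,1)] K(2) by auto
  show "self_eval (indexed_const k) = k" if "k \<in> K"
  proof -
    have "self_eval (indexed_const k) = (\<Oplus>m\<in>{{#}}. indexed_const k m \<otimes> monomial m)"
      using indexed_pset.indexed_const[OF that]
      by (rule self_eval_superset[OF K]) (auto simp: indexed_const_def)
    thus ?thesis using that K by (auto simp: indexed_const_def monomial_def)
  qed
  have coeff: "P m \<in> carrier R" if "P \<in> indexed_pset I K" for P m
    by (rule carrier_coeffE[OF supp(1)[OF that]])
  show closed: "self_eval P \<in> carrier R" if "P \<in> indexed_pset I K" for P
    unfolding self_eval_def monomial_def[symmetric]
    using monomial_closed mc[OF _ that] coeff[OF that] by (intro finsum_closed) auto
  show "self_eval (indexed_padd P Q) = self_eval P \<oplus> self_eval Q"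
    if P: "P \<in> indexed_pset I K" and Q: "Q \<in> indexed_pset I K"
  proof -
    let ?A = "{m. P m \<noteq> \<zero>} \<union> {m. Q m \<noteq> \<zero>}"
    have A: "finite ?A" "\<And>m. m \<in> ?A \<Longrightarrow> set_mset m \<subseteq> carrier R"
      using supp(2)[OF P] supp(2)[OF Q] mc[OF _ P] mc[OF _ Q] by auto
    note eval = self_eval_superset[OF K _ A(1) _ A(2)]
    have "self_eval (indexed_padd P Q) = (\<Oplus>m\<in>?A. indexed_padd P Q m \<otimes> monomial m)"
      by (rule eval[OF indexed_pset.indexed_padd[OF P Q]]) (auto simp: indexed_padd_def)
    also have "\<dots> = (\<Oplus>m\<in>?A. P m \<otimes> monomial m \<oplus> Q m \<otimes> monomial m)"
      using monomial_closed[OF A(2)] coeff[OF P] coeff[OF Q]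
      by (intro add.finprod_cong') (auto simp: indexed_padd_def l_distr)
    also have "\<dots> = (\<Oplus>m\<in>?A. P m \<otimes> monomial m) \<oplus> (\<Oplus>m\<in>?A. Q m \<otimes> monomial m)"
      using monomial_closed[OF A(2)] coeff[OF P] coeff[OF Q] by (intro finsum_addf) blast+
    also have "\<dots> = self_eval P \<oplus> self_eval Q" using eval[OF P] eval[OF Q] by auto
    finally show ?thesis .
  qed
  show "self_eval (indexed_pmult P i) = self_eval P \<otimes> i"
    if P: "P \<in> indexed_pset I K" and i: "i \<in> I"
  proof -
    let ?A = "{m. P m \<noteq> \<zero>}"
    have iR: "i \<in> carrier R" using i K(2) by auto
    have supp_A: "{m. indexed_pmult P i m \<noteq> \<zero>} \<subseteq> add_mset i ` ?A"
      by (auto simp: indexed_pmult_def image_iff dest!: multi_member_split split: if_splits)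
    have "self_eval (indexed_pmult P i) =
        (\<Oplus>m\<in>add_mset i ` ?A. indexed_pmult P i m \<otimes> monomial m)"
    proof (rule self_eval_superset[OF K indexed_pset.indexed_pmult[OF P i] _ supp_A])
      show "finite (add_mset i ` ?A)" using supp(2)[OF P] by simp
      show "set_mset m \<subseteq> carrier R" if "m \<in> add_mset i ` ?A" for m
        using that mc[OF _ P] iR by fastforce
    qed
    also have "\<dots> = (\<Oplus>m\<in>?A. indexed_pmult P i (add_mset i m) \<otimes> monomial (add_mset i m))"
    proof (intro add.finprod_reindex)
      show "(\<lambda>m. indexed_pmult P i m \<otimes> monomial m) \<in> add_mset i ` ?A \<rightarrow> carrier R"
        using mc[OF _ P] iR coeff[OF P]
        by (fastforce simp: indexed_pmult_def intro!: m_closed monomial_closed)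
    qed (simp add: inj_on_def)
    also have "\<dots> = (\<Oplus>m\<in>?A. (P m \<otimes> monomial m) \<otimes> i)"
      using mc[OF _ P] iR coeff[OF P] monomial_closed
      by (intro add.finprod_cong') (auto simp: indexed_pmult_def monomial_add_mset m_assoc)
    also have "\<dots> = (\<Oplus>m\<in>?A. P m \<otimes> monomial m) \<otimes> i"
      using mc[OF _ P] iR coeff[OF P] monomial_closed
      by (intro finsum_ldistr[symmetric] supp(2)[OF P]) auto
    finally show ?thesis unfolding self_eval_def monomial_def .
  qed
qed

lemma indexed_pset_mono:
  assumes "I \<subseteq> J" "P \<in> indexed_pset I K" shows "P \<in> indexed_pset J K"
  using assms(2,1) by induct (auto intro: indexed_pset.intros)

lemma indexed_pset_index_free:
  assumes "P \<in> indexed_pset I K" "i \<notin> I" shows "index_free P i"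
  using assms
proof induct
  case (indexed_pmult P j)
  have "indexed_pmult P j m = \<zero>" if "i \<in># m" for m
  proof -
    have "i \<in># m - {#j#}" using that indexed_pmult by (auto simp: in_diff_count)
    thus ?thesis using indexed_pmult by (auto simp: index_free_def indexed_pmult_def)
  qed
  thus ?case by (simp add: index_free_def)
qed (auto simp: index_free_def indexed_const_def indexed_padd_def)

text \<open>The polynomial expressions in \<open>I\<close> over \<open>K\<close> are closed under products, by induction on the
  construction of one factor: scalars first, then sums and multiplication by a variable.\<close>

lemma subring_self_eval:
  assumes K: "subring K R" "I \<subseteq> carrier R"
  shows "subring (self_eval ` indexed_pset I K) R"
    and "K \<subseteq> self_eval ` indexed_pset I K" and "I \<subseteq> self_eval ` indexed_pset I K"
proof -
  let ?M = "self_eval ` indexed_pset I K"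
  have KR: "K \<subseteq> carrier R" by (rule subringE(1)[OF K(1)])
  note eval = self_eval_const[OF KR K(2)] self_eval_padd[OF KR K(2)] self_eval_pmult[OF KR K(2)]
  have MR: "?M \<subseteq> carrier R" using self_eval_closed[OF KR K(2)] by auto
  show KM: "K \<subseteq> ?M"
    using eval(1) indexed_pset.indexed_const by (metis image_eqI subsetI)
  have add: "x \<oplus> y \<in> ?M" if xy: "x \<in> ?M" "y \<in> ?M" for x y
  proof -
    obtain P Q where "P \<in> indexed_pset I K" "x = self_eval P" "Q \<in> indexed_pset I K" "y = self_eval Q"
      using xy by auto
    thus ?thesis using eval(2)[of P Q] indexed_pset.indexed_padd[of P I K Q] by (metis imageI)
  qed
  have mult_I: "x \<otimes> i \<in> ?M" if xi: "x \<in> ?M" "i \<in> I" for x i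
  proof -
    obtain P where "P \<in> indexed_pset I K" "x = self_eval P" using xi by auto
    thus ?thesis using eval(3)[of P i] indexed_pset.indexed_pmult[of P I K i] xi(2) by (metis imageI)
  qed
  show "I \<subseteq> ?M" using mult_I[of \<one>] KM subringE(3)[OF K(1)] K(2) by fastforce
  have mult_K: "x \<otimes> k \<in> ?M" if x: "x \<in> ?M" and k: "k \<in> K" for x k
  proof -
    obtain P where "P \<in> indexed_pset I K" "x = self_eval P" using x by auto
    thus ?thesis
    proof (induct arbitrary: x)
      case (indexed_const c)
      thus ?case using eval(1) KM k subringE(6)[OF K(1)] by auto
    next
      case (indexed_padd P Q)
      hence "x \<otimes> k = self_eval P \<otimes> k \<oplus> self_eval Q \<otimes> k"
        using eval(2) self_eval_closed[OF KR K(2)] k KR by (simp add: l_distr subset_iff)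
      thus ?case using add indexed_padd by simp
    next
      case (indexed_pmult P i)
      hence "x \<otimes> k = (self_eval P \<otimes> k) \<otimes> i"
        using eval(3) self_eval_closed[OF KR K(2)] k KR K(2) by (simp add: m_ac subset_iff)
      thus ?case using mult_I indexed_pmult by simp
    qed
  qed
  have mult: "x \<otimes> y \<in> ?M" if x: "x \<in> ?M" and y: "y \<in> ?M" for x y
  proof -
    have xR: "x \<in> carrier R" using x MR by auto
    obtain P where "P \<in> indexed_pset I K" "y = self_eval P" using y by auto
    thus ?thesis
    proof (induct arbitrary: y)
      case (indexed_const c)
      thus ?case using eval(1) mult_K[OF x] by simp
    next
      case (indexed_padd P Q)
      hence "x \<otimes> y = x \<otimes> self_eval P \<oplus> x \<otimes> self_eval Q"
        using eval(2) self_eval_closed[OF KR K(2)] xR by (simp add: r_distr)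
      thus ?case using add indexed_padd by simp
    next
      case (indexed_pmult P i)
      hence "x \<otimes> y = (x \<otimes> self_eval P) \<otimes> i"
        using eval(3) self_eval_closed[OF KR K(2)] xR K(2) by (simp add: m_assoc subset_iff)
      thus ?case using mult_I indexed_pmult by simp
    qed
  qed
  show "subring ?M R"
  proof (rule subringI[OF MR])
    show one: "\<one> \<in> ?M" using KM subringE(3)[OF K(1)] by auto
    show "\<ominus> x \<in> ?M" if "x \<in> ?M" for x
      using mult_K[OF that subringE(5)[OF K(1) subringE(3)[OF K(1)]]] that MR
      by (simp add: r_minus subset_iff)
  qed (use add mult in auto)
qed

text \<open>A relation for \<open>d\<close> over the fractions of \<open>K[\<Delta> - {d}]\<close> can be cleared of denominators. By Horner's
  scheme it is then the value of a polynomial in the variables \<open>\<Delta>\<close>, which algebraic independence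
  forces to be zero. As the coefficients do not involve \<open>d\<close>, each step \<open>Q \<mapsto> Q d + P\<close> of the scheme
  keeps \<open>Q d\<close> and \<open>P\<close> apart (they have no monomial in common), so every coefficient is zero.\<close>

lemma algebraically_independent_transcendental:
  assumes K: "subfield K R" and \<Delta>: "algebraically_independent K \<Delta>" and d: "d \<in> \<Delta>"
  shows "(transcendental over (adjoin K (\<Delta> - {d}))) d"
proof -
  let ?D = "\<Delta> - {d}"
  let ?M = "self_eval ` indexed_pset ?D K"
  have KR: "subring K R" "K \<subseteq> carrier R" using subfieldE(1,3)[OF K] by auto
  have \<Delta>R: "\<Delta> \<subseteq> carrier R" using \<Delta> by (simp add: algebraically_independent_def)
  hence DR: "?D \<subseteq> carrier R" and dR: "d \<in> carrier R" using d by auto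
  note M = subring_self_eval[OF KR(1) DR]
  have poly: "\<exists>Q \<in> indexed_pset \<Delta> K. self_eval Q = eval q d \<and>
      (Q = indexed_const \<zero> \<longrightarrow> set q \<subseteq> {\<zero>})" if "set q \<subseteq> ?M" for q
    using that
  proof (induct q rule: rev_induct)
    case Nil
    have "\<zero> \<in> K" by (rule subringE(2)[OF KR(1)])
    thus ?case
      using indexed_pset.indexed_const[of \<zero> K \<Delta>] self_eval_const[OF KR(2) \<Delta>R] by fastforce
  next
    case (snoc b q)
    then obtain Q where Q: "Q \<in> indexed_pset \<Delta> K" "self_eval Q = eval q d"
      "Q = indexed_const \<zero> \<longrightarrow> set q \<subseteq> {\<zero>}" by auto
    obtain P where P: "P \<in> indexed_pset ?D K" "b = self_eval P" using snoc by auto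
    have P\<Delta>: "P \<in> indexed_pset \<Delta> K" by (rule indexed_pset_mono[OF _ P(1)]) auto
    let ?Q = "indexed_padd (indexed_pmult Q d) P"
    note Qd = indexed_pset.indexed_pmult[OF Q(1) d]
    have "self_eval ?Q = self_eval Q \<otimes> d \<oplus> b"
      using self_eval_padd[OF KR(2) \<Delta>R Qd P\<Delta>] self_eval_pmult[OF KR(2) \<Delta>R Q(1) d] P(2) by simp
    also have "\<dots> = eval (q @ [b]) d"
      using snoc(2) subringE(1)[OF M(1)] dR Q(2) by (subst eval_append_aux) auto
    finally have eval: "self_eval ?Q = eval (q @ [b]) d" .
    have "set (q @ [b]) \<subseteq> {\<zero>}" if "?Q = indexed_const \<zero>"
    proof -
      have zero: "indexed_pmult Q d m \<oplus> P m = \<zero>" for m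
        using fun_cong[OF that, of m] by (simp add: indexed_padd_def indexed_const_def)
      have free: "P m = \<zero>" if "d \<in># m" for m
        using indexed_pset_index_free[OF P(1), of d] that by (auto simp: index_free_def)
      have coeff: "P m \<in> carrier R" "Q m \<in> carrier R" for m
        using carrier_coeffE[OF indexed_pset_props(1)[OF KR(2)]] P(1) Q(1) by auto
      have "P m = \<zero>" for m
        using zero[of m] free[of m] coeff[of m] by (cases "d \<in># m") (auto simp: indexed_pmult_def)
      hence P0: "P = indexed_const \<zero>" by (auto simp: indexed_const_def)
      have "Q m = \<zero>" for m
        using zero[of "add_mset d m"] free[of "add_mset d m"] coeff[of m] by (simp add: indexed_pmult_def)
      hence "Q = indexed_const \<zero>" by (auto simp: indexed_const_def)
      thus ?thesis
        using P0 P(2) Q(3) self_eval_const[OF KR(2) \<Delta>R subringE(2)[OF KR(1)]] by auto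
    qed
    thus ?case using eval indexed_pset.indexed_padd[OF Qd P\<Delta>] by blast
  qed
  have "(transcendental over ?M) d"
    unfolding transcendental_iff_no_relation[OF M(1) dR]
  proof (intro allI impI)
    fix q assume q: "set q \<subseteq> ?M" "eval q d = \<zero>"
    then obtain Q where "Q \<in> indexed_pset \<Delta> K" "self_eval Q = \<zero>"
      "Q = indexed_const \<zero> \<longrightarrow> set q \<subseteq> {\<zero>}" using poly by metis
    thus "set q \<subseteq> {\<zero>}" using \<Delta> unfolding algebraically_independent_def by blast
  qed
  moreover have "adjoin K ?D \<subseteq> fractions ?M"
    using M fractions_incl[OF M(1)] by (intro adjoin_min subfield_fractions) auto
  ultimately show ?thesis
    using transcendental_mono transcendental_over_fractions[OF M(1) dR] by blast
qed

text \<open>The element \<open>x\<close> involves only finitely many variables. If it lies in \<open>K(D)(d)\<close> and in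
  \<open>K(\<Delta> - {d})\<close>, over which \<open>d\<close> is transcendental, then it already lies in \<open>K(D)\<close>.\<close>

lemma adjoin_omit_Int:
  assumes K: "subfield K R" and \<Delta>: "algebraically_independent K \<Delta>"
    and x: "x \<in> adjoin K \<Delta>" "\<And>d. d \<in> \<Delta> \<Longrightarrow> x \<in> adjoin K (\<Delta> - {d})"
  shows "x \<in> K"
proof -
  have KR: "K \<subseteq> carrier R" by (rule subfieldE(3)[OF K])
  have \<Delta>R: "\<Delta> \<subseteq> carrier R" using \<Delta> by (simp add: algebraically_independent_def)
  obtain D where D: "finite D" "D \<subseteq> \<Delta>" "x \<in> adjoin K D"
    using adjoin_finitary[OF KR \<Delta>R x(1)] by auto
  thus ?thesis
  proof (induct D)
    case empty
    have "adjoin K {} \<subseteq> K" by (rule adjoin_min[OF K]) auto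
    thus ?case using empty by auto
  next
    case (insert d D)
    have DR: "D \<subseteq> carrier R" "d \<in> carrier R" "\<Delta> - {d} \<subseteq> carrier R" using insert \<Delta>R by auto
    have "x \<in> adjoin K D"
    proof (rule adjoin_transcendental_Int)
      show "subfield (adjoin K D) R" "subfield (adjoin K (\<Delta> - {d})) R"
        using adjoin_props(1)[OF KR] DR by auto
      show "adjoin K D \<subseteq> adjoin K (\<Delta> - {d})" using insert by (intro adjoin_mono KR DR) auto
      show "(transcendental over (adjoin K (\<Delta> - {d}))) d"
        using insert by (intro algebraically_independent_transcendental K \<Delta>) auto
      show "x \<in> adjoin K (\<Delta> - {d})" using x(2) insert by auto
      show "x \<in> adjoin (adjoin K D) {d}" using insert adjoin_insert[OF KR DR(1,2)] by simp
    qed (use DR in auto)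
    thus ?case using insert by auto
  qed
qed

lemma infinite_subfield_transcendental:
  assumes F: "subfield F R" and K: "subfield K R" and t: "t \<in> F" "(transcendental over K) t"
  shows "infinite F"
proof -
  have "inj (\<lambda>n. eval (monom \<one> n) t)"
  proof (rule injI)
    fix m n assume eq: "eval (monom \<one> m) t = eval (monom \<one> n) t"
    have "monom \<one> k \<in> carrier (K[X])" for k
      using monom_is_polynomial[OF subfieldE(1)[OF K]] subringE(3)[OF subfieldE(1)[OF K]]
      by (simp add: univ_poly_carrier[symmetric])
    hence "monom \<one> m = monom \<one> n"
      using t(2) eq by (auto simp: over_def transcendental_def inj_on_def)
    hence "length (monom \<one> m) = length (monom \<one> n)" by simp
    thus "m = n" by (simp add: monom_def)
  qed
  moreover have "eval (monom \<one> n) t \<in> F" for n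
  proof -
    have "t \<in> carrier R" using t(1) subfieldE(3)[OF F] by auto
    moreover have "t [^] n \<in> F"
      using t(1) subringE(3,6)[OF subfieldE(1)[OF F]] by (induct n) auto
    ultimately show ?thesis by (simp add: eval_monom)
  qed
  ultimately show ?thesis by (metis finite_subset image_subsetI range_inj_infinite)
qed

section \<open>Linear disjointness\<close>

text \<open>Expanding the coefficients of \<open>p\<close> with respect to \<open>vs\<close> writes \<open>p\<close> as a combination of polynomials
  over \<open>K\<close> with coefficients \<open>vs\<close>; if all of these are zero, then so is \<open>p\<close>.\<close>

lemma eval_coordinates:
  assumes K: "subfield K R" and a: "a \<in> carrier R"
    and "set vs \<subseteq> carrier R" "set p \<subseteq> Span K vs"
  shows "\<exists>qs. length qs = length vs \<and> (\<forall>q \<in> set qs. set q \<subseteq> K) \<and>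
    eval p a = combine (map (\<lambda>q. eval q a) qs) vs \<and> (set qs \<subseteq> {q. set q \<subseteq> {\<zero>}} \<longrightarrow> set p \<subseteq> {\<zero>})"
  using assms(3,4)
proof (induct vs arbitrary: p)
  case Nil
  hence "p = replicate (length p) \<zero> @ []"
    by (metis append_Nil2 replicate_length_same singletonD subsetD Span.simps foldr_Nil id_apply)
  hence "eval p a = \<zero>" using eval_replicate[of "[]" a "length p"] a by simp
  thus ?case using Nil by auto
next
  case (Cons v vs)
  have KR: "K \<subseteq> carrier R" by (rule subfieldE(3)[OF K])
  have v: "v \<in> carrier R" "set vs \<subseteq> carrier R" using Cons(2) by auto
  have SR: "Span K vs \<subseteq> carrier R" by (rule Span_in_carrier[OF KR v(2)])
  have "\<exists>p' q. length p' = length q \<and> set q \<subseteq> K \<and> set p' \<subseteq> Span K vs \<and>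
      p = map2 (\<lambda>u k. u \<oplus> v \<otimes> k) p' q"
    using Cons(3)
  proof (induct p)
    case Nil
    show ?case by (intro exI[of _ "[]"]) simp
  next
    case (Cons c p)
    then obtain p' q where p': "length p' = length q" "set q \<subseteq> K"
      "set p' \<subseteq> Span K vs" "p = map2 (\<lambda>u k. u \<oplus> v \<otimes> k) p' q" by auto
    obtain k u where ku: "k \<in> K" "u \<in> Span K vs" "c = k \<otimes> v \<oplus> u"
      using Cons(2) line_extension_mem_iff[of c K v "Span K vs"] by auto
    have "k \<in> carrier R" "u \<in> carrier R" using ku(1,2) SR KR by auto
    hence "c = u \<oplus> v \<otimes> k" using ku(3) v by (simp add: a_comm m_comm)
    hence eq: "c # p = map2 (\<lambda>u k. u \<oplus> v \<otimes> k) (u # p') (k # q)" using p'(4) by simp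
    show ?case
      by (rule exI[of _ "u # p'"], rule exI[of _ "k # q"], intro conjI eq)
        (use p'(1-3) ku(1,2) in simp_all)
  qed
  then obtain p' q where q: "length p' = length q" "set q \<subseteq> K"
    "set p' \<subseteq> Span K vs" "p = map2 (\<lambda>u k. u \<oplus> v \<otimes> k) p' q"
    by (elim exE conjE) (rule that)
  obtain qs where qs: "length qs = length vs" "\<forall>q \<in> set qs. set q \<subseteq> K"
    "eval p' a = combine (map (\<lambda>q. eval q a) qs) vs" "set qs \<subseteq> {q. set q \<subseteq> {\<zero>}} \<longrightarrow> set p' \<subseteq> {\<zero>}"
    using Cons(1)[OF v(2) q(3)] by blast
  have R: "set q \<subseteq> carrier R" "set p' \<subseteq> carrier R" using q KR SR by auto
  have "eval p a = eval p' a \<oplus> v \<otimes> eval q a"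
    unfolding q(4) by (rule eval_map2_add_mult[OF q(1) R(2,1) v(1) a])
  hence "eval p a = combine (map (\<lambda>q. eval q a) (q # qs)) (v # vs)"
    using qs(3) eval_in_carrier[OF R(1) a] eval_in_carrier[OF R(2) a] v(1) by (simp add: a_comm m_comm)
  moreover have "set p \<subseteq> {\<zero>}" if "set (q # qs) \<subseteq> {q. set q \<subseteq> {\<zero>}}"
  proof
    fix c assume "c \<in> set p"
    then obtain u k where uk: "(u, k) \<in> set (zip p' q)" "c = u \<oplus> v \<otimes> k"
      unfolding q(4) by auto
    hence "u \<in> set p'" "k \<in> set q" by (auto dest: set_zip_leftD set_zip_rightD)
    hence "u = \<zero>" "k = \<zero>" using that qs(4) by auto
    thus "c \<in> {\<zero>}" using uk(2) v(1) by simp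
  qed
  ultimately show ?case using qs(1,2) q(2) by (intro exI[of _ "q # qs"]) simp
qed

text \<open>Expand the coefficients of an equation for \<open>a\<close> over \<open>E\<close> in a \<open>K\<close>-basis of their span. This gives a
  relation among basis elements with coefficients \<open>q(a) \<in> F\<close>, where \<open>q\<close> runs over polynomials over
  \<open>K\<close>. By linear disjointness every \<open>q(a)\<close> is zero, and some \<open>q\<close> is a nonzero polynomial.\<close>

lemma linearly_disjoint_algebraic:
  assumes K: "subfield K R" and E: "subfield E R" "K \<subseteq> E" and F: "subfield F R" "K \<subseteq> F"
    and ld: "linearly_disjoint K E F"
    and a: "a \<in> F" "(algebraic over E) a"
  shows "(algebraic over K) a"
proof (rule ccontr)
  assume "\<not> (algebraic over K) a"
  hence tr: "(transcendental over K) a" by (simp add: over_def)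
  have aR: "a \<in> carrier R" using a(1) subfieldE(3)[OF F(1)] by auto
  obtain p where p: "p \<in> carrier (E[X])" "p \<noteq> []" "eval p a = \<zero>"
    by (rule algebraicE[OF subfieldE(1)[OF E(1)] aR a(2)])
  have pE: "set p \<subseteq> E" "hd p \<noteq> \<zero>" using p(1,2) unfolding sym[OF univ_poly_carrier] polynomial_def by auto
  have pR: "set p \<subseteq> carrier R" using pE subfieldE(3)[OF E(1)] by auto
  obtain vs where vs: "set vs \<subseteq> carrier R" "independent K vs" "Span K vs = Span K p"
    by (rule filter_base[OF K pR])
  have "subalgebra K E R"
    using E subringE(6)[OF subfieldE(1)[OF E(1)]] subring.axioms(1)[OF subfieldE(1)[OF E(1)]]
    by (auto simp: subalgebra_def subalgebra_axioms_def)
  hence "Span K p \<subseteq> E" using subalgebra_Span_incl[OF K _ pE(1)] by auto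
  hence "set vs \<subseteq> E" using Span_base_incl[OF K vs(1)] vs(3) by auto
  hence indep: "independent F vs" using ld vs(2) by (auto simp: linearly_disjoint_def)
  obtain qs where qs: "length qs = length vs" "\<forall>q \<in> set qs. set q \<subseteq> K"
    "eval p a = combine (map (\<lambda>q. eval q a) qs) vs" "set qs \<subseteq> {q. set q \<subseteq> {\<zero>}} \<longrightarrow> set p \<subseteq> {\<zero>}"
    using eval_coordinates[OF K aR vs(1), of p] Span_base_incl[OF K pR] vs(3) by metis
  have "eval q a \<in> F" if "set q \<subseteq> K" for q
    using that
  proof (induct q rule: rev_induct)
    case Nil thus ?case using subringE(2)[OF subfieldE(1)[OF F(1)]] by simp
  next
    case (snoc b q)
    hence "eval (q @ [b]) a = eval q a \<otimes> a \<oplus> b" using aR subfieldE(3)[OF K] by (intro eval_append_aux) auto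
    thus ?case using snoc a(1) F(2) subringE(6,7)[OF subfieldE(1)[OF F(1)]] by auto
  qed
  hence "set (map (\<lambda>q. eval q a) qs) \<subseteq> F" using qs(2) by auto
  hence "set (take (length vs) (map (\<lambda>q. eval q a) qs)) \<subseteq> {\<zero>}"
    using independent_imp_trivial_combine[OF F(1) indep] qs(3) p(3) by metis
  hence "\<forall>q \<in> set qs. eval q a = \<zero>" using qs(1) by auto
  hence "set qs \<subseteq> {q. set q \<subseteq> {\<zero>}}"
    using qs(2) tr transcendental_iff_no_relation[OF subfieldE(1)[OF K] aR] by blast
  thus False using qs(4) pE(2) p(2) by (metis list.set_sel(1) singletonD subsetD)
qed

section \<open>Purely transcendental extensions\<close>

context
  fixes K \<Delta> :: "'a set"
  assumes K: "subfield K R" and \<Delta>: "algebraically_independent K \<Delta>"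
    and carrier_eq: "carrier R = adjoin K \<Delta>"
begin

lemma simple_transcendental_over_rest:
  assumes "d \<in> \<Delta>"
  shows "subfield (adjoin K (\<Delta> - {d})) R" "K \<subseteq> adjoin K (\<Delta> - {d})"
    "\<Delta> - {d} \<subseteq> adjoin K (\<Delta> - {d})" "d \<in> carrier R"
    "(transcendental over (adjoin K (\<Delta> - {d}))) d"
    "carrier R = adjoin (adjoin K (\<Delta> - {d})) {d}"
proof -
  have KR: "K \<subseteq> carrier R" by (rule subfieldE(3)[OF K])
  have DR: "\<Delta> - {d} \<subseteq> carrier R" and dR: "d \<in> carrier R"
    using \<Delta> assms by (auto simp: algebraically_independent_def)
  show "subfield (adjoin K (\<Delta> - {d})) R" "K \<subseteq> adjoin K (\<Delta> - {d})"
    "\<Delta> - {d} \<subseteq> adjoin K (\<Delta> - {d})" using adjoin_props[OF KR DR] by auto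
  show "d \<in> carrier R" by (rule dR)
  show "(transcendental over (adjoin K (\<Delta> - {d}))) d"
    by (rule algebraically_independent_transcendental[OF K \<Delta> assms])
  show "carrier R = adjoin (adjoin K (\<Delta> - {d})) {d}"
    using adjoin_insert[OF KR DR dR] assms carrier_eq by (simp add: insert_absorb)
qed

text \<open>Being algebraic over \<open>K\<close> implies being algebraic over each \<open>K(\<Delta> - {d})\<close>, hence membership in each.\<close>

lemma algebraic_in_base:
  assumes "x \<in> carrier R" "(algebraic over K) x" shows "x \<in> K"
proof (rule adjoin_omit_Int[OF K \<Delta>])
  show "x \<in> adjoin K \<Delta>" using assms(1) carrier_eq by simp
  fix d assume d: "d \<in> \<Delta>"
  note s = simple_transcendental_over_rest[OF d]
  show "x \<in> adjoin K (\<Delta> - {d})"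
    using algebraic_in_adjoin_transcendental[OF s(1,4,5)] s(6) assms algebraic_mono[OF s(2)] by auto
qed

text \<open>The excluded case is genuine: for finite \<open>K\<close> the automorphism group \<open>PGL\<^sub>2(K)\<close> of \<open>K(t)\<close> over \<open>K\<close> is
  finite, so that \<open>K(t)\<close> has finite degree over its fixed field.
  Otherwise every \<open>K(\<Delta> - {d})\<close> is infinite, and the translations of \<open>d\<close> by its elements suffice.\<close>

lemma galois_purely_transcendental:
  assumes "\<not> (finite K \<and> card \<Delta> = 1)" shows "galois K"
proof -
  have KR: "K \<subseteq> carrier R" by (rule subfieldE(3)[OF K])
  have "x \<in> K" if x: "x \<in> carrier R" "\<forall>\<sigma>\<in>Gal K. \<sigma> x = x" for x
  proof (rule adjoin_omit_Int[OF K \<Delta>])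
    show "x \<in> adjoin K \<Delta>" using x(1) carrier_eq by simp
    fix d assume d: "d \<in> \<Delta>"
    let ?F = "adjoin K (\<Delta> - {d})"
    note s = simple_transcendental_over_rest[OF d]
    have "infinite ?F"
    proof (cases "finite K")
      case True
      hence "\<Delta> \<noteq> {d}" using assms by auto
      \<comment> \<open>A second variable \<open>e\<close> lies in \<open>K(\<Delta> - {d})\<close>, and its powers are distinct.\<close>
      then obtain e where e: "e \<in> \<Delta>" "e \<noteq> d" using d by auto
      note se = simple_transcendental_over_rest[OF e(1)]
      show ?thesis
        using transcendental_mono[OF se(2,5)] s(3) e by (intro infinite_subfield_transcendental[OF s(1) K, of e]) auto
    next
      case False
      thus ?thesis using s(2) finite_subset by auto
    qed
    hence "galois ?F" by (rule galois_adjoin_transcendental[OF s(1) _ s(4-6)])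
    moreover have "Gal ?F \<subseteq> Gal K" using s(2) by (auto simp: Gal_def)
    ultimately show "x \<in> ?F" using x unfolding galois_def by blast
  qed
  thus ?thesis using KR unfolding galois_def Gal_def by blast
qed

text \<open>The elements of \<open>A\<close> are algebraic over \<open>K(S)\<close>, hence over \<open>K\<close> by linear disjointness, hence
  they lie in \<open>K\<close>; so \<open>A\<close> spans nothing beyond \<open>K(S)\<close>.\<close>

lemma linearly_disjoint_basis_generates:
  assumes "(S, A) \<in> linearly_disjoint_bases K"
  shows "adjoin K S = carrier R"
proof -
  have KR: "K \<subseteq> carrier R" by (rule subfieldE(3)[OF K])
  have SA: "transcendence_basis K S" "linear_basis (adjoin K S) A"
    "linearly_disjoint K (adjoin K S) (adjoin K A)"
    using assms by (auto simp: linearly_disjoint_bases_def nice_basis_def)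
  have SR: "S \<subseteq> carrier R" and AR: "A \<subseteq> carrier R"
    using SA by (auto simp: transcendence_basis_def algebraically_independent_def linear_basis_def)
  note S = adjoin_props[OF KR SR] and A' = adjoin_props[OF KR AR]
  have "A \<subseteq> K"
  proof
    fix a assume a: "a \<in> A"
    have "(algebraic over (adjoin K S)) a"
      using SA(1) a AR by (auto simp: transcendence_basis_def algebraic_extension_def)
    hence "(algebraic over K) a"
      using linearly_disjoint_algebraic[OF K S(1,2) A'(1,2) SA(3)] A'(3) a by blast
    thus "a \<in> K" using algebraic_in_base a AR by blast
  qed
  have "subalgebra (adjoin K S) (adjoin K S) R"
    using subringE(6)[OF subfieldE(1)[OF S(1)]] subring.axioms(1)[OF subfieldE(1)[OF S(1)]]
    by (auto simp: subalgebra_def subalgebra_axioms_def)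
  hence "Span (adjoin K S) us \<subseteq> adjoin K S" if "set us \<subseteq> A" for us
    using that \<open>A \<subseteq> K\<close> S(2) by (intro subalgebra_Span_incl[OF S(1)]) auto
  hence "carrier R \<subseteq> adjoin K S" using SA(2) unfolding linear_basis_def by blast
  thus ?thesis using S(4) by auto
qed

lemma algebraic_extension_carrier: "algebraic_extension (carrier R)"
  using algebraic_self[OF carrier_is_subring] by (simp add: algebraic_extension_def)

lemma galois_carrier: "galois (carrier R)"
  by (auto simp: galois_def Gal_def)

lemma linearly_disjoint_basis_trivial: "(\<Delta>, {\<one>}) \<in> linearly_disjoint_bases K"
proof -
  have "independent (carrier R) us" if us: "distinct us" "set us \<subseteq> {\<one>}" for us
  proof (cases us)
    case Nil thus ?thesis by simp
  next
    case (Cons u vs)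
    hence "us = [\<one>]" using us by (cases vs) auto
    thus ?thesis using li_Cons[of \<one> "carrier R" "[]"] by simp
  qed
  moreover have "x \<in> Span (carrier R) [\<one>]" if "x \<in> carrier R" for x
    using that by (auto simp: line_extension_mem_iff intro!: bexI[of _ x])
  hence "\<exists>us. set us \<subseteq> {\<one>} \<and> x \<in> Span (carrier R) us" if "x \<in> carrier R" for x
    using that by (intro exI[of _ "[\<one>]"]) simp
  ultimately have "nice_basis K \<Delta> {\<one>}"
    using \<Delta> algebraic_extension_carrier
    by (simp add: nice_basis_def transcendence_basis_def linear_basis_def carrier_eq[symmetric])
  moreover have "adjoin K {\<one>} = K"
  proof
    have "\<one> \<in> K" by (rule subringE(3)[OF subfieldE(1)[OF K]])
    thus "adjoin K {\<one>} \<subseteq> K" by (intro adjoin_min[OF K]) auto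
    show "K \<subseteq> adjoin K {\<one>}" using adjoin_props(2)[OF subfieldE(3)[OF K]] by simp
  qed
  ultimately show ?thesis by (simp add: linearly_disjoint_bases_def linearly_disjoint_def)
qed

lemma strong_galois_purely_transcendental: "strong_galois K"
  using linearly_disjoint_basis_trivial linearly_disjoint_basis_generates
    algebraic_extension_carrier galois_carrier
  by (fastforce simp: strong_galois_def)

end

end

theorem proposition3p9:
  fixes L :: "('a, 'b) ring_scheme" and K \<Delta> :: "'a set"
  assumes "field L" and "subfield K L"
    and "countable \<Delta>"
    and "ring.algebraically_independent L K \<Delta>"
    and "carrier L = ring.adjoin L K \<Delta>"
  shows "(\<not> (finite K \<and> card \<Delta> = 1) \<longrightarrow> ring.galois L K) \<and> ring.strong_galois L K"
proof -
  interpret field L by fact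
  show ?thesis
    using galois_purely_transcendental[OF assms(2,4,5)]
      strong_galois_purely_transcendental[OF assms(2,4,5)] by blast
qed

end
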